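(* (Shared projector induces coherent cross-layer interference under Pre-LN transport.) Consider the Pre-LN student and the multi-layer distillation loss $\mathcal{L}_{\mathrm{align}}$ defined in the context, with $A_k$, $J_{p_{\phi_l}}$, $g_l$, $v_l$, $G$, $\mathcal{G}$ as defined there. Assume residual-smallness: there exists $\varepsilon>0$ such that $\|A_k\|\le\varepsilon$ for all $k$ of interest. Then the gradient at an earlier representation $h_i$ admits the superposition form $$\nabla_{h_i}\mathcal{L}_{\mathrm{align}}=\sum_{l\in\mathcal{S}:\,l\ge i}\alpha_l\,J_{p_{\phi_l}}(h_l)^\top g_l+\mathcal{E}_i,$$ where the error $\mathcal{E}_i$ is bounded by order $$O\Big(\varepsilon\sum_{l\ge i}(l-i)\,\alpha_l\,\|J_{p_{\phi_l}}^\top g_l\|\Big).$$ For the shared projector parameterization ($\phi_l\equiv\phi$ for all $l\in\mathcal{S}$), assume: (i) (bounded residual increments) there exists $\delta>0$ such that $\|h_{l+1}-h_l\|_2\le\delta$ for all layers $l$; (ii) (projector Jacobian Lipschitz) there exists $L_J>0$ such that $\|J_{p_\phi}(x)-J_{p_\phi}(y)\|_2\le L_J\|x-y\|_2$ for all $x,y$ in the bounded feature domain; (iii) (near-isometry on the error-signal subspace) for a reference layer $\bar l\in\mathcal{S}$, with $\bar h:=h_{\bar l}$, $J:=J_{p_\phi}(\bar h)$ and $M:=JJ^\top\succeq0$, there exist constants $c>0$ and $\eta\in[0,1)$ such that for all $x\in\mathcal{G}$, $$(1-\eta)c\,\|x\|_2^2\le x^\top Mx\le(1+\eta)c\,\|x\|_2^2.$$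 Then for any $a,b\in\mathcal{S}$ with $a,b\ge i$ and $g_a,g_b\in\mathcal{G}$, the cross-layer interference term $\langle v_a,v_b\rangle$ satisfies the shared-projector decomposition $$\langle v_a,v_b\rangle=g_a^\top\big(J_{p_\phi}(h_a)J_{p_\phi}(h_b)^\top\big)g_b=g_a^\top Mg_b+\Delta_{ab},$$ with deviation bounded by $$|\Delta_{ab}|\le\|g_a\|_2\|g_b\|_2\Big(\|E_a\|_2\|J\|_2+\|E_b\|_2\|J\|_2+\|E_a\|_2\|E_b\|_2\Big),$$ where $J_{p_\phi}(h_l)=J+E_l$ with $\|E_l\|_2\le L_J|l-\bar l|\delta$; and furthermore it admits the signal-aligned lower bound $$\langle v_a,v_b\rangle\ \ge\ c\,g_a^\top g_b-\eta c\cdot\frac{\|g_a\|_2^2+\|g_b\|_2^2}{2}-|\Delta_{ab}|.$$ Consequently, when teacher-side error signals are positively correlated across layers (large $g_a^\top g_b$) and the controlled-deviation terms are small, shared-projector gradients exhibit reduced destructive interference and higher cross-layer coherence in the superposition $G\approx\sum_{l\in\mathcal{S}:\,l\ge i}\alpha_l v_l$.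
   Context: The student network is a Pre-LN Transformer written on the residual stream: $h_{l+1}=h_l+F_l(\mathrm{LN}(h_l);\theta_l)$ for $l=0,\dots,L-1$, where $h_l\in\mathbb{R}^d$ is the (flattened) residual representation at layer $l$, $\mathrm{LN}$ is LayerNorm and $\theta_l$ are the block parameters. Write $u_l:=\mathrm{LN}(h_l)$ and $$A_l:=\frac{\partial F_l(u_l;\theta_l)}{\partial u_l}\,J_{\mathrm{LN}}(h_l),$$ where $J_f(x)$ denotes the Jacobian of $f$ at $x$; thus $\partial h_{l+1}/\partial h_l=I+A_l$. Let $\mathcal{S}$ be the set of distillation layers. For each $l\in\mathcal{S}$ a two-layer MLP projector $p_{\phi_l}$ is attached, of the form $p_\phi(h)=W_2\,\sigma(W_1\,\mathrm{LN}_v(h))$, with $\sigma=\mathrm{GELU}$, input normalization $\mathrm{LN}_v$, and $\phi=\{W_1,W_2\}$ (and potentially the parameters of $\mathrm{LN}_v$). Set $z_l:=p_{\phi_l}(h_l)$ and let $t_l$ be the teacher representation used as the distillation target for the student's layer $l$, selected via a fixed layer mapping. The multi-layer distillation loss is $$\mathcal{L}_{\mathrm{align}}=\sum_{l\in\mathcal{S}}\alpha_l\,\ell(z_l,t_l),$$ where $\ell$ is any differentiable similarity loss (e.g. one minus cosine similarity) and $\alpha_l\ge0$ are weights. Define $g_l:=\nabla_{z_l}\ell(z_l,t_l)$ and $v_l:=J_{p_{\phi_l}}(h_l)^\top g_l$. The gradient at $h_i$ is obtained by back-propagation through the residual blocks from all $h_l$ with $l\in\mathcal{S}$, $l\ge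 i$. The superposed gradient is $G\approx\sum_{l\in\mathcal{S}:\,l\ge i}\alpha_l v_l$, whose squared norm expands as $$\|G\|_2^2=\sum_l\alpha_l^2\|v_l\|_2^2+\sum_{a\ne b}\alpha_a\alpha_b\langle v_a,v_b\rangle,$$ so that the cross-layer interference terms $\langle v_a,v_b\rangle$ determine whether different distillation layers reinforce or cancel each other. The error-signal subspace is $\mathcal{G}:=\mathrm{span}\{g_l:l\in\mathcal{S}\}\subseteq\mathbb{R}^{\dim(z)}$. *)

theory Defs
  imports "HOL-Analysis.Analysis" "HOL-Probability.Probability"
begin

text \<open>
  The flattened residual representation is a vector indexed by pairs (token, feature), so the
  ambient dimension is the product of the number of tokens and the feature width.  LayerNorm
  normalises the features of each token separately; with a one-element token type this is
  LayerNorm of the whole vector.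
\<close>

type_synonym ('t, 'm) resid = "real ^ ('t \<times> 'm)"

record 'm ln_params =
  ln_gain :: "real ^ 'm"
  ln_bias :: "real ^ 'm"
  ln_eps :: real

definition token_mean :: "('t::finite, 'm::finite) resid \<Rightarrow> 't \<Rightarrow> real" where
  "token_mean x s = (\<Sum>j\<in>UNIV. x $ (s, j)) / real CARD('m)"

definition token_var :: "('t::finite, 'm::finite) resid \<Rightarrow> 't \<Rightarrow> real" where
  "token_var x s = (\<Sum>j\<in>UNIV. (x $ (s, j) - token_mean x s)\<^sup>2) / real CARD('m)"

definition layer_norm ::
    "'m ln_params \<Rightarrow> ('t::finite, 'm::finite) resid \<Rightarrow> ('t, 'm) resid" where
  "layer_norm p x = vec_lambda (\<lambda>(s, j).
     ln_gain p $ j * ((x $ (s, j) - token_mean x s) / sqrt (token_var x s + ln_eps p))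
       + ln_bias p $ j)"

definition gelu :: "real \<Rightarrow> real" where
  "gelu x = x * cdf std_normal_distribution x"

text \<open>
  The weight matrices act on the flattened vector; a projector applied token by token is the
  special case of block-diagonal weights.
\<close>

record ('t, 'm, 'k, 'z) projector =
  weight1 :: "real ^ ('t \<times> 'm) ^ 'k"
  weight2 :: "real ^ 'k ^ 'z"
  proj_norm :: "'m ln_params"

definition project ::
    "('t::finite, 'm::finite, 'k::finite, 'z::finite) projector \<Rightarrow> ('t, 'm) resid \<Rightarrow> real ^ 'z" where
  "project \<phi> x =
     weight2 \<phi> *v (\<chi> r. gelu ((weight1 \<phi> *v layer_norm (proj_norm \<phi>) x) $ r))"

text \<open>The spectral norm; the library norm of a matrix is the Frobenius norm.\<close>

definition opnorm :: "real ^ 'n::finite ^ 'm::finite \<Rightarrow> real" where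
  "opnorm A = onorm ((*v) A)"

definition gradient :: "('a::real_inner \<Rightarrow> real) \<Rightarrow> 'a \<Rightarrow> 'a" where
  "gradient f x = (THE D. GDERIV f x :> D)"

text \<open>
  A student network on a fixed input, with its distillation data.  Block parameters have an
  arbitrary type; the block function takes the layer index, its normalised input and its
  parameters.
\<close>

record ('t, 'm, 'p, 'k, 'z) distillation =
  depth :: nat
  input :: "('t, 'm) resid"
  student_norm :: "'m ln_params"
  block :: "nat \<Rightarrow> ('t, 'm) resid \<Rightarrow> 'p \<Rightarrow> ('t, 'm) resid"
  block_params :: "nat \<Rightarrow> 'p"
  distill_layers :: "nat set"
  weight :: "nat \<Rightarrow> real"
  proj :: "nat \<Rightarrow> ('t, 'm, 'k, 'z) projector"
  sim_loss :: "real ^ 'z \<Rightarrow> real ^ 'z \<Rightarrow> real"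
  teacher :: "nat \<Rightarrow> real ^ 'z"

definition layer_step ::
    "('t::finite, 'm::finite, 'p, 'k::finite, 'z::finite) distillation \<Rightarrow> nat \<Rightarrow> ('t, 'm) resid \<Rightarrow> ('t, 'm) resid" where
  "layer_step N l x = x + block N l (layer_norm (student_norm N) x) (block_params N l)"

primrec forward ::
    "('t::finite, 'm::finite, 'p, 'k::finite, 'z::finite) distillation \<Rightarrow> nat \<Rightarrow> ('t, 'm) resid \<Rightarrow> nat \<Rightarrow> ('t, 'm) resid" where
  "forward N i x 0 = x"
| "forward N i x (Suc n) = layer_step N (i + n) (forward N i x n)"

definition hidden ::
    "('t::finite, 'm::finite, 'p, 'k::finite, 'z::finite) distillation \<Rightarrow> nat \<Rightarrow> ('t, 'm) resid" where
  "hidden N l = forward N 0 (input N) l"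

text \<open>
  The hidden states obtained when the state at layer \<open>i\<close> is replaced by \<open>x\<close>: earlier states are
  unaffected, later ones are recomputed.
\<close>

definition rerun ::
    "('t::finite, 'm::finite, 'p, 'k::finite, 'z::finite) distillation \<Rightarrow> nat \<Rightarrow> ('t, 'm) resid \<Rightarrow> nat \<Rightarrow> ('t, 'm) resid" where
  "rerun N i x l = (if i \<le> l then forward N i x (l - i) else hidden N l)"

definition align_loss ::
    "('t::finite, 'm::finite, 'p, 'k::finite, 'z::finite) distillation \<Rightarrow> (nat \<Rightarrow> ('t, 'm) resid) \<Rightarrow> real" where
  "align_loss N h =
     (\<Sum>l\<in>distill_layers N. weight N l * sim_loss N (project (proj N l) (h l)) (teacher N l))"

definition block_jac ::
    "('t::finite, 'm::finite, 'p, 'k::finite, 'z::finite) distillation \<Rightarrow> nat \<Rightarrow> real ^ ('t \<times> 'm) ^ ('t \<times> 'm)" where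
  "block_jac N l =
     jacobian (\<lambda>u. block N l u (block_params N l)) (at (layer_norm (student_norm N) (hidden N l)))
       ** jacobian (layer_norm (student_norm N)) (at (hidden N l))"

definition proj_out ::
    "('t::finite, 'm::finite, 'p, 'k::finite, 'z::finite) distillation \<Rightarrow> nat \<Rightarrow> real ^ 'z" where
  "proj_out N l = project (proj N l) (hidden N l)"

definition proj_jac ::
    "('t::finite, 'm::finite, 'p, 'k::finite, 'z::finite) distillation \<Rightarrow> nat \<Rightarrow> real ^ ('t \<times> 'm) ^ 'z" where
  "proj_jac N l = jacobian (project (proj N l)) (at (hidden N l))"

definition err_signal ::
    "('t::finite, 'm::finite, 'p, 'k::finite, 'z::finite) distillation \<Rightarrow> nat \<Rightarrow> real ^ 'z" where
  "err_signal N l = gradient (\<lambda>z. sim_loss N z (teacher N l)) (proj_out N l)"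

definition back_signal ::
    "('t::finite, 'm::finite, 'p, 'k::finite, 'z::finite) distillation \<Rightarrow> nat \<Rightarrow> ('t, 'm) resid" where
  "back_signal N l = transpose (proj_jac N l) *v err_signal N l"

definition err_space ::
    "('t::finite, 'm::finite, 'p, 'k::finite, 'z::finite) distillation \<Rightarrow> (real ^ 'z) set" where
  "err_space N = span (err_signal N ` distill_layers N)"

definition later_layers :: "('t::finite, 'm::finite, 'p, 'k::finite, 'z::finite) distillation \<Rightarrow> nat \<Rightarrow> nat set" where
  "later_layers N i = {l \<in> distill_layers N. i \<le> l}"

definition superposed ::
    "('t::finite, 'm::finite, 'p, 'k::finite, 'z::finite) distillation \<Rightarrow> nat \<Rightarrow> ('t, 'm) resid" where
  "superposed N i = (\<Sum>l\<in>later_layers N i. weight N l *\<^sub>R back_signal N l)"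

text \<open>
  Differentiability is required only at the points the network visits; this admits losses such as
  one minus cosine similarity, which is not differentiable at the origin.
\<close>

definition well_posed ::
    "('t::finite, 'm::finite, 'p, 'k::finite, 'z::finite) distillation \<Rightarrow> bool" where
  "well_posed N \<longleftrightarrow>
     distill_layers N \<subseteq> {..depth N}
     \<and> 0 < ln_eps (student_norm N)
     \<and> (\<forall>l<depth N. (\<lambda>u. block N l u (block_params N l))
            differentiable at (layer_norm (student_norm N) (hidden N l)))
     \<and> (\<forall>l\<in>distill_layers N.
          0 \<le> weight N l
          \<and> 0 < ln_eps (proj_norm (proj N l))
          \<and> (\<lambda>z. sim_loss N z (teacher N l)) differentiable at (proj_out N l))"

definition residual_small ::
    "('t::finite, 'm::finite, 'p, 'k::finite, 'z::finite) distillation \<Rightarrow> nat \<Rightarrow> real \<Rightarrow> bool" where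
  "residual_small N i \<epsilon> \<longleftrightarrow>
     (\<forall>k. i \<le> k \<and> (\<exists>l\<in>distill_layers N. k < l) \<longrightarrow> opnorm (block_jac N k) \<le> \<epsilon>)"

definition near_isometry_on :: "(real ^ 'z::finite) set \<Rightarrow> real ^ 'z ^ 'z \<Rightarrow> real \<Rightarrow> real \<Rightarrow> bool" where
  "near_isometry_on V M c \<eta> \<longleftrightarrow>
     (\<forall>x\<in>V. (1 - \<eta>) * c * (norm x)\<^sup>2 \<le> x \<bullet> (M *v x) \<and> x \<bullet> (M *v x) \<le> (1 + \<eta>) * c * (norm x)\<^sup>2)"

end

theory Submission
  imports Defs
begin


text \<open>
  By the chain rule the exact gradient at layer \<open>i\<close> is the sum of the back-signals \<open>v\<^sub>l\<close>, each
  multiplied by the transpose of \<open>P = (I + A\<^bsub>l-1\<^esub>) \<dots> (I + A\<^sub>i)\<close>.  Since every \<open>A\<^sub>k\<close> has norm at most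
  \<open>\<epsilon>\<close>, the operator \<open>P\<^sup>T - I\<close> has norm at most \<open>(1 + \<epsilon>)\<^bsup>l-i\<^esup> - 1\<close>, which is at most
  \<open>(1 + \<epsilon>\<^sub>0)\<^sup>L \<epsilon> (l - i)\<close>.  For a shared projector, expanding \<open>(J + E\<^sub>a) (J + E\<^sub>b)\<^sup>T\<close> around
  \<open>J J\<^sup>T\<close> bounds the deviation, and polarization turns the near-isometry of the quadratic form
  into the lower bound on the bilinear form.
\<close>

text \<open>Otherwise the simplifier turns \<open>transpose A *v x\<close> into
  \<open>x v* A\<close>, and the facts about transposes no longer match.\<close>

declare transpose_matrix_vector [simp del]

section \<open>Differentiability of GELU, LayerNorm and the projector\<close>

lemma cdf_density_has_real_derivative:
  fixes f :: "real \<Rightarrow> real"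
  assumes "integrable lborel f" "\<And>x. 0 \<le> f x" and cont: "continuous_on UNIV f"
  shows "(cdf (density lborel f) has_real_derivative f x) (at x)"
proof -
  have meas [measurable]: "f \<in> borel_measurable borel"
    using assms(1) by auto
  have set_int: "set_integrable lborel S f" if "S \<in> sets borel" for S
    using integrable_mult_indicator [of S lborel f] assms(1) that
    by (simp add: set_integrable_def)
  have hk: "f integrable_on S" if "S \<in> sets borel" for S
    using set_borel_integral_eq_integral(1)[OF set_int] that by blast
  \<comment> \<open>Passing from the measure of a half-line to the gauge integral makes the
    fundamental theorem of calculus applicable.\<close>
  have cdf: "cdf (density lborel f) u = integral {..u} f" for u
  proof -
    have "cdf (density lborel f) u = integral\<^sup>L (density lborel f) (indicator {..u})"
      by (simp add: cdf_def)
    also have "\<dots> = (LINT t : {..u} | lborel. f t)"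
      by (subst integral_density)
        (use assms in \<open>auto simp: set_lebesgue_integral_def mult.commute\<close>)
    also have "\<dots> = integral {..u} f"
      using set_borel_integral_eq_integral(2)[OF set_int] by auto
    finally show ?thesis .
  qed
  \<comment> \<open>Cutting at \<open>x - 1\<close> leaves a tail that is constant in
    \<open>u\<close> and an integral from a fixed end point. The identity holds on a neighbourhood
    of \<open>x\<close>, which suffices for the derivative at \<open>x\<close>.\<close>
  have split: "cdf (density lborel f) u = integral {..x - 1} f + integral {x - 1..u} f"
    if "x - 1 \<le> u" for u
  proof -
    have "negligible ({..x - 1} \<inter> {x - 1..u})"
      using that by (intro negligible_subset [OF negligible_sing [of "x - 1"]]) auto
    moreover have "{..u} = {..x - 1} \<union> {x - 1..u}"
      using that by auto
    ultimately show ?thesis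
      unfolding cdf by (metis integral_Un hk atMost_borel atLeastAtMost_borel)
  qed
  have "((\<lambda>u. integral {x - 1..u} f) has_real_derivative f x) (at x within {x - 1..x + 1})"
    by (rule integral_has_real_derivative) (auto intro: continuous_on_subset [OF cont])
  then have "((\<lambda>u. integral {x - 1..u} f) has_real_derivative f x) (at x)"
    by (simp add: at_within_Icc_at)
  then have "((\<lambda>u. integral {..x - 1} f + integral {x - 1..u} f) has_real_derivative f x) (at x)"
    by (auto intro!: derivative_eq_intros)
  then show ?thesis
    by (rule has_field_derivative_transform_within_open [of _ _ _ "{x - 1<..}"])
      (auto simp: split)
qed

lemma gelu_differentiable: "gelu differentiable at x"
proof -
  have "continuous_on UNIV std_normal_density"
    unfolding std_normal_density_def by (intro continuous_intros) auto
  then have "(cdf std_normal_distribution has_real_derivative std_normal_density x) (at x)"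
    by (intro cdf_density_has_real_derivative) auto
  then have "cdf std_normal_distribution differentiable at x"
    using real_differentiable_def by blast
  then show ?thesis
    unfolding gelu_def [abs_def] by (intro derivative_intros)
qed

lemma differentiable_vec_lambda:
  fixes f :: "'a::real_normed_vector \<Rightarrow> real ^ 'n::finite"
  assumes "\<And>i. (\<lambda>x. f x $ i) differentiable at x"
  shows "f differentiable at x"
  using assms
  by (subst differentiable_componentwise_within) (auto simp: Basis_vec_def inner_axis)

lemma matrix_vector_differentiable:
  fixes A :: "real ^ 'n::finite ^ 'm::finite"
  shows "((*v) A) differentiable at x"
  by (rule bounded_linear_imp_differentiable) simp

lemma vec_nth_differentiable: "(\<lambda>x::real ^ 'n::finite. x $ i) differentiable at x"
  by (rule bounded_linear_imp_differentiable) (rule bounded_linear_vec_nth)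

text \<open>Positivity of \<open>ln_eps p\<close> keeps the radicand positive even for a token whose
  features all coincide, so the square root is differentiable and the denominator nonzero.\<close>

lemma layer_norm_differentiable:
  fixes x :: "('t::finite, 'm::finite) resid"
  assumes "0 < ln_eps p"
  shows "layer_norm p differentiable at x"
proof (rule differentiable_vec_lambda)
  fix i :: "'t \<times> 'm"
  obtain s j where i: "i = (s, j)" by fastforce
  have mean: "(\<lambda>x::('t, 'm) resid. token_mean x s) differentiable at x"
    unfolding token_mean_def by (intro derivative_intros ballI vec_nth_differentiable) auto
  have var: "(\<lambda>x::('t, 'm) resid. token_var x s + ln_eps p) differentiable at x"
    unfolding token_var_def by (intro derivative_intros ballI vec_nth_differentiable mean) auto
  have "0 \<le> token_var x s"
    unfolding token_var_def by (simp add: sum_nonneg)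
  then have pos: "0 < token_var x s + ln_eps p"
    using assms by simp
  have "sqrt differentiable at (token_var x s + ln_eps p)"
    using DERIV_real_sqrt [OF pos] real_differentiable_def by blast
  from differentiable_compose [OF this var]
  have "(\<lambda>x::('t, 'm) resid. sqrt (token_var x s + ln_eps p)) differentiable at x" .
  then have "(\<lambda>x::('t, 'm) resid. ln_gain p $ j *
      ((x $ (s, j) - token_mean x s) / sqrt (token_var x s + ln_eps p)) + ln_bias p $ j) differentiable at x"
    using pos by (intro derivative_intros vec_nth_differentiable mean) simp_all
  then show "(\<lambda>x. layer_norm p x $ i) differentiable at x"
    by (simp only: layer_norm_def i vec_lambda_beta case_prod_conv)
qed

text \<open>By the chain rule the projector is smooth enough by itself, so \<open>well_posed\<close>
  only has to ask for a positive \<open>ln_eps\<close> of its normalization.\<close>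

lemma project_differentiable:
  assumes "0 < ln_eps (proj_norm \<phi>)"
  shows "project \<phi> differentiable at x"
proof -
  have "(\<lambda>x. weight1 \<phi> *v layer_norm (proj_norm \<phi>) x) differentiable at x"
    by (rule differentiable_compose [OF matrix_vector_differentiable layer_norm_differentiable])
      (rule assms)
  then have "(\<lambda>x. (weight1 \<phi> *v layer_norm (proj_norm \<phi>) x) $ r) differentiable at x" for r
    by (rule differentiable_compose [OF vec_nth_differentiable])
  then have "(\<lambda>x. gelu ((weight1 \<phi> *v layer_norm (proj_norm \<phi>) x) $ r)) differentiable at x" for r
    by (rule differentiable_compose [OF gelu_differentiable])
  then have "(\<lambda>x. \<chi> r. gelu ((weight1 \<phi> *v layer_norm (proj_norm \<phi>) x) $ r)) differentiable at x"
    by (intro differentiable_vec_lambda) simp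
  then show ?thesis
    unfolding project_def [abs_def] by (rule differentiable_compose [OF matrix_vector_differentiable])
qed

section \<open>Transposes, the spectral norm and gradients\<close>

lemma inner_transpose_matrix_vector:
  fixes A :: "real ^ 'n::finite ^ 'm::finite"
  shows "(transpose A *v x) \<bullet> y = x \<bullet> (A *v y)"
  by (simp add: dot_lmul_matrix transpose_matrix_vector)

lemma inner_matrix_vector_transpose:
  fixes A :: "real ^ 'n::finite ^ 'm::finite"
  shows "y \<bullet> (transpose A *v x) = (A *v y) \<bullet> x"
  by (metis inner_commute inner_transpose_matrix_vector)

lemma norm_matrix_vector_le_opnorm:
  fixes A :: "real ^ 'n::finite ^ 'm::finite"
  shows "norm (A *v x) \<le> opnorm A * norm x"
  unfolding opnorm_def by (rule onorm) simp

lemma opnorm_nonneg: "0 \<le> opnorm A"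
  unfolding opnorm_def by (rule onorm_pos_le) simp

text \<open>With \<open>y = transpose A *v x\<close>, Cauchy-Schwarz applied to
  \<open>y \<bullet> y = x \<bullet> (A *v y)\<close> gives the bound after one factor
  \<open>norm y\<close> is cancelled.\<close>

lemma norm_transpose_le_opnorm:
  fixes A :: "real ^ 'n::finite ^ 'm::finite"
  shows "norm (transpose A *v x) \<le> opnorm A * norm x"
proof (cases "transpose A *v x = 0")
  case False
  let ?y = "transpose A *v x"
  have "(norm ?y)\<^sup>2 = x \<bullet> (A *v ?y)"
    by (simp add: power2_norm_eq_inner inner_transpose_matrix_vector)
  also have "\<dots> \<le> norm x * (opnorm A * norm ?y)"
    by (meson norm_cauchy_schwarz norm_matrix_vector_le_opnorm norm_ge_zero mult_left_mono order_trans)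
  finally show ?thesis
    using False by (simp add: power2_eq_square algebra_simps)
qed (simp add: opnorm_nonneg)

text \<open>In finite dimension the derivative is represented by a vector, and uniqueness of that
  vector justifies the definite description in \<open>gradient\<close>.\<close>

lemma GDERIV_gradient:
  fixes f :: "'a::euclidean_space \<Rightarrow> real"
  assumes "f differentiable at x"
  shows "GDERIV f x :> gradient f x"
proof -
  obtain f' where f': "(f has_derivative f') (at x)"
    using assms differentiable_def by blast
  then have lin: "linear f'"
    by (rule has_derivative_linear)
  \<comment> \<open>The Riesz representative of a functional is its adjoint evaluated at 1.\<close>
  define D where "D = adjoint f' 1"
  have "f' h = h \<bullet> D" for h
    using adjoint_works [OF lin, of h 1] by (simp add: D_def)
  then have "f' = (\<lambda>h. h \<bullet> D)"
    by blast
  with f' have "GDERIV f x :> D"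
    by (simp add: gderiv_def)
  moreover have "D' = D" if "GDERIV f x :> D'" for D'
  proof -
    have "(\<lambda>h. h \<bullet> D') = (\<lambda>h. h \<bullet> D)"
      using has_derivative_unique that \<open>GDERIV f x :> D\<close> unfolding gderiv_def by blast
    then have "h \<bullet> D' = h \<bullet> D" for h
      by meson
    then show ?thesis
      using vector_eq_ldot by blast
  qed
  ultimately show ?thesis
    unfolding gradient_def by (rule theI)
qed

section \<open>Transport through the residual blocks\<close>

lemma forward_hidden: "forward N i (hidden N i) n = hidden N (i + n)"
  by (induction n) (simp_all add: hidden_def)

text \<open>This is the product \<open>P\<close> of the overview with \<open>n = l - i\<close>: the
  Jacobian of \<open>n\<close> residual steps from layer \<open>i\<close>, later blocks on the
  left.\<close>

primrec transport ::
    "('t::finite, 'm::finite, 'p, 'k::finite, 'z::finite) distillation \<Rightarrow> nat \<Rightarrow> nat \<Rightarrow> real ^ ('t \<times> 'm) ^ ('t \<times> 'm)" where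
  "transport N i 0 = mat 1"
| "transport N i (Suc n) = (mat 1 + block_jac N (i + n)) ** transport N i n"

lemma layer_step_has_derivative:
  assumes "well_posed N" "l < depth N"
  shows "(layer_step N l has_derivative (\<lambda>h. (mat 1 + block_jac N l) *v h)) (at (hidden N l))"
proof -
  let ?LN = "layer_norm (student_norm N)" and ?h = "hidden N l"
  have LN: "(?LN has_derivative (*v) (jacobian ?LN (at ?h))) (at ?h)"
    using assms layer_norm_differentiable jacobian_works unfolding well_posed_def by blast
  have B: "((\<lambda>u. block N l u (block_params N l)) has_derivative
      (*v) (jacobian (\<lambda>u. block N l u (block_params N l)) (at (?LN ?h)))) (at (?LN ?h))"
    using assms jacobian_works unfolding well_posed_def by blast
  have "((\<lambda>x. x + block N l (?LN x) (block_params N l)) has_derivative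
      (\<lambda>h. h + jacobian (\<lambda>u. block N l u (block_params N l)) (at (?LN ?h))
        *v (jacobian ?LN (at ?h) *v h))) (at ?h)"
    by (intro has_derivative_add has_derivative_ident has_derivative_compose [OF LN B])
  then show ?thesis
    unfolding layer_step_def [abs_def]
    by (simp add: block_jac_def matrix_vector_mult_add_rdistrib matrix_vector_mul_assoc)
qed

lemma forward_has_derivative:
  assumes "well_posed N" "i + n \<le> depth N"
  shows "((\<lambda>x. forward N i x n) has_derivative (*v) (transport N i n)) (at (hidden N i))"
  using assms(2)
proof (induction n)
  case 0
  show ?case by simp
next
  case (Suc n)
  then have IH: "((\<lambda>x. forward N i x n) has_derivative (*v) (transport N i n)) (at (hidden N i))"
    by simp
  \<comment> \<open>The base point lies on the trajectory of the network, so its iterate is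
    \<open>hidden N (i + n)\<close>, the very point at which \<open>block_jac\<close> is
    taken.\<close>
  have "(layer_step N (i + n) has_derivative (\<lambda>h. (mat 1 + block_jac N (i + n)) *v h))
      (at (forward N i (hidden N i) n))"
    using layer_step_has_derivative [OF assms(1)] Suc.prems by (simp add: forward_hidden)
  from has_derivative_compose [OF IH this] show ?case
    by (simp add: matrix_vector_mul_assoc)
qed

text \<open>Transposition reverses the product, so the last block acts first: it sends
  \<open>v\<close> to \<open>w\<close>, and the induction hypothesis is used at \<open>w\<close>,
  whence the arbitrary \<open>v\<close>. The relative error obeys
  \<open>e' = (1 + \<epsilon>) * e + \<epsilon>\<close> with \<open>e = 0\<close> initially, which
  is solved by \<open>(1 + \<epsilon>) ^ n - 1\<close>.\<close>

lemma norm_transport_diff_le: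
  assumes "\<And>k. i \<le> k \<Longrightarrow> k < i + n \<Longrightarrow> opnorm (block_jac N k) \<le> \<epsilon>"
  shows "norm (transpose (transport N i n) *v v - v) \<le> ((1 + \<epsilon>) ^ n - 1) * norm v"
  using assms
proof (induction n arbitrary: v)
  case (Suc n)
  let ?A = "block_jac N (i + n)" and ?P = "transport N i n"
  define w where "w = v + transpose ?A *v v"
  have small: "opnorm ?A \<le> \<epsilon>"
    using Suc.prems by simp
  then have eps: "0 \<le> \<epsilon>"
    using opnorm_nonneg order_trans by blast
  have Av: "norm (transpose ?A *v v) \<le> \<epsilon> * norm v"
    by (meson norm_transpose_le_opnorm small mult_right_mono norm_ge_zero order_trans)
  then have w: "norm w \<le> (1 + \<epsilon>) * norm v"
    unfolding w_def using norm_triangle_ineq [of v "transpose ?A *v v"] by (simp add: algebra_simps)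
  have "transpose (mat 1 + ?A) = mat 1 + transpose ?A"
    by (simp add: transpose_def mat_def vec_eq_iff)
  then have "transpose (transport N i (Suc n)) *v v - v = (transpose ?P *v w - w) + transpose ?A *v v"
    by (simp add: w_def matrix_transpose_mul matrix_vector_mult_add_rdistrib
        flip: matrix_vector_mul_assoc)
  then have "norm (transpose (transport N i (Suc n)) *v v - v)
      \<le> norm (transpose ?P *v w - w) + norm (transpose ?A *v v)"
    by (simp add: norm_triangle_ineq)
  also have "norm (transpose ?P *v w - w) \<le> ((1 + \<epsilon>) ^ n - 1) * norm w"
    using Suc by simp
  also have "\<dots> \<le> ((1 + \<epsilon>) ^ n - 1) * ((1 + \<epsilon>) * norm v)"
    using w eps by (intro mult_left_mono) auto
  finally show ?case
    using Av by (simp add: algebra_simps)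
qed simp

text \<open>The left side telescopes into \<open>n\<close> increments
  \<open>\<epsilon> * (1 + \<epsilon>) ^ k\<close>, each at most
  \<open>\<epsilon> * (1 + \<epsilon>\<^sub>0) ^ L\<close>. This makes the exponential error linear
  in \<epsilon> and in the layer distance.\<close>

lemma power_growth_le:
  fixes \<epsilon> :: real
  assumes "0 \<le> \<epsilon>" "\<epsilon> \<le> \<epsilon>\<^sub>0" "n \<le> L"
  shows "(1 + \<epsilon>) ^ n - 1 \<le> (1 + \<epsilon>\<^sub>0) ^ L * (\<epsilon> * real n)"
  using assms(3)
proof (induction n)
  case (Suc n)
  have "(1 + \<epsilon>) ^ n \<le> (1 + \<epsilon>\<^sub>0) ^ n"
    using assms by (intro power_mono) auto
  also have "\<dots> \<le> (1 + \<epsilon>\<^sub>0) ^ L"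
    using assms Suc.prems by (intro power_increasing) auto
  finally have "\<epsilon> * (1 + \<epsilon>) ^ n \<le> \<epsilon> * (1 + \<epsilon>\<^sub>0) ^ L"
    using assms by (intro mult_left_mono) auto
  then show ?case
    using Suc by (simp add: algebra_simps)
qed simp

section \<open>The exact gradient and its superposition form\<close>

lemma align_loss_has_gradient:
  fixes N :: "('t::finite, 'm::finite, 'p, 'k::finite, 'z::finite) distillation"
  assumes wp: "well_posed N"
  shows "GDERIV (\<lambda>x. align_loss N (rerun N i x)) (hidden N i) :>
    (\<Sum>l\<in>later_layers N i. weight N l *\<^sub>R (transpose (transport N i (l - i)) *v back_signal N l))"
proof -
  let ?h = "hidden N i"
  \<comment> \<open>Layers before \<open>i\<close> get 0, since \<open>rerun\<close> keeps their
    states fixed and their loss terms are constant in \<open>x\<close>.\<close>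
  let ?G = "\<lambda>l. if i \<le> l then weight N l *\<^sub>R (transpose (transport N i (l - i)) *v back_signal N l) else 0"
  have fin: "finite (distill_layers N)"
    using wp finite_subset unfolding well_posed_def by blast
  have "((\<lambda>x. weight N l * sim_loss N (project (proj N l) (rerun N i x l)) (teacher N l))
      has_derivative (\<lambda>h. h \<bullet> ?G l)) (at ?h)" if l: "l \<in> distill_layers N" for l
  proof (cases "i \<le> l")
    case True
    define n where "n = l - i"
    then have l_eq: "l = i + n"
      using True by simp
    have "i + n \<le> depth N"
      using wp l unfolding well_posed_def l_eq by auto
    from forward_has_derivative [OF wp this]
    have F: "((\<lambda>x. forward N i x n) has_derivative (*v) (transport N i n)) (at ?h)" .
    have "project (proj N l) differentiable at (hidden N l)"
      using wp l by (intro project_differentiable) (auto simp: well_posed_def)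
    then have P: "(project (proj N l) has_derivative (*v) (proj_jac N l)) (at (forward N i ?h n))"
      by (simp add: jacobian_works proj_jac_def forward_hidden l_eq)
    have "GDERIV (\<lambda>z. sim_loss N z (teacher N l)) (proj_out N l) :> err_signal N l"
      unfolding err_signal_def using wp l by (intro GDERIV_gradient) (auto simp: well_posed_def)
    then have S: "((\<lambda>z. sim_loss N z (teacher N l)) has_derivative (\<lambda>h. h \<bullet> err_signal N l))
        (at (project (proj N l) (forward N i ?h n)))"
      by (simp add: gderiv_def proj_out_def forward_hidden l_eq)
    have "((\<lambda>x. weight N l * sim_loss N (project (proj N l) (forward N i x n)) (teacher N l))
        has_derivative (\<lambda>h. weight N l * ((proj_jac N l *v (transport N i n *v h)) \<bullet> err_signal N l))) (at ?h)"
      by (intro has_derivative_mult_right has_derivative_compose [OF has_derivative_compose [OF F P] S])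
    \<comment> \<open>Moving both Jacobians across the inner product turns the forward derivative
      into back-propagation.\<close>
    moreover have "(\<lambda>h. weight N l * ((proj_jac N l *v (transport N i n *v h)) \<bullet> err_signal N l)) =
        (\<lambda>h. h \<bullet> ?G l)"
      using True unfolding n_def back_signal_def
      by (simp add: inner_matrix_vector_transpose)
    ultimately have "((\<lambda>x. weight N l * sim_loss N (project (proj N l) (forward N i x n)) (teacher N l))
        has_derivative (\<lambda>h. h \<bullet> ?G l)) (at ?h)"
      by (rule has_derivative_eq_rhs)
    then show ?thesis
      using True by (simp add: rerun_def n_def)
  qed (simp add: rerun_def)
  then have "((\<lambda>x. align_loss N (rerun N i x)) has_derivative
      (\<lambda>h. \<Sum>l\<in>distill_layers N. h \<bullet> ?G l)) (at ?h)"
    unfolding align_loss_def by (rule has_derivative_sum)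
  moreover have "(\<Sum>l\<in>distill_layers N. ?G l) =
      (\<Sum>l\<in>later_layers N i. weight N l *\<^sub>R (transpose (transport N i (l - i)) *v back_signal N l))"
    unfolding later_layers_def using fin by (simp add: sum.inter_filter)
  ultimately show ?thesis
    by (simp add: gderiv_def flip: inner_sum_right)
qed

lemma align_loss_gradient_superposition:
  fixes N :: "('t::finite, 'm::finite, 'p, 'k::finite, 'z::finite) distillation"
  assumes wp: "well_posed N" and small: "residual_small N i \<epsilon>"
    and eps: "0 < \<epsilon>" "\<epsilon> \<le> \<epsilon>\<^sub>0" and L: "depth N = L"
  shows "\<exists>\<E>. GDERIV (\<lambda>x. align_loss N (rerun N i x)) (hidden N i) :>
      ((\<Sum>l\<in>later_layers N i. weight N l *\<^sub>R back_signal N l) + \<E>)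
    \<and> norm \<E> \<le> (1 + \<epsilon>\<^sub>0) ^ L *
      (\<epsilon> * (\<Sum>l\<in>later_layers N i. (real l - real i) * weight N l * norm (back_signal N l)))"
proof -
  let ?T = "\<lambda>l. transpose (transport N i (l - i)) *v back_signal N l - back_signal N l"
  \<comment> \<open>The error is the exact gradient minus the superposition, collected layer by
    layer.\<close>
  define \<E> where "\<E> = (\<Sum>l\<in>later_layers N i. weight N l *\<^sub>R ?T l)"
  have term_le: "norm (weight N l *\<^sub>R ?T l)
      \<le> (1 + \<epsilon>\<^sub>0) ^ L * (\<epsilon> * ((real l - real i) * weight N l * norm (back_signal N l)))"
    if "l \<in> later_layers N i" for l
  proof -
    from that have l: "l \<in> distill_layers N" "i \<le> l"
      by (auto simp: later_layers_def)
    then have "l \<le> L" "0 \<le> weight N l"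
      using wp L by (auto simp: well_posed_def)
    have "norm (?T l) \<le> ((1 + \<epsilon>) ^ (l - i) - 1) * norm (back_signal N l)"
      using small l by (intro norm_transport_diff_le) (auto simp: residual_small_def)
    also have "(1 + \<epsilon>) ^ (l - i) - 1 \<le> (1 + \<epsilon>\<^sub>0) ^ L * (\<epsilon> * real (l - i))"
      using eps \<open>l \<le> L\<close> by (intro power_growth_le) auto
    finally have "norm (?T l) \<le> (1 + \<epsilon>\<^sub>0) ^ L * (\<epsilon> * real (l - i)) * norm (back_signal N l)"
      by (simp add: mult_right_mono)
    \<comment> \<open>A nonnegative weight passes through the norm unchanged, and
      \<open>i \<le> l\<close> makes the natural difference agree with the real one.\<close>
    from mult_left_mono [OF this \<open>0 \<le> weight N l\<close>] show ?thesis
      using \<open>0 \<le> weight N l\<close> l by (simp add: of_nat_diff ac_simps)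
  qed
  have "norm \<E> \<le> (\<Sum>l\<in>later_layers N i.
      (1 + \<epsilon>\<^sub>0) ^ L * (\<epsilon> * ((real l - real i) * weight N l * norm (back_signal N l))))"
    unfolding \<E>_def by (rule sum_norm_le) (rule term_le)
  moreover have "(\<Sum>l\<in>later_layers N i. weight N l *\<^sub>R back_signal N l) + \<E> =
      (\<Sum>l\<in>later_layers N i. weight N l *\<^sub>R (transpose (transport N i (l - i)) *v back_signal N l))"
    unfolding \<E>_def by (simp add: scaleR_diff_right flip: sum.distrib)
  ultimately show ?thesis
    using align_loss_has_gradient [OF wp, of i] by (intro exI [of _ \<E>]) (simp add: sum_distrib_left)
qed

section \<open>Interference under a shared projector\<close>

lemma near_isometry_inner_ge:
  fixes V :: "(real ^ 'z::finite) set" and J :: "real ^ 'n::finite ^ 'z"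
  assumes iso: "near_isometry_on V (J ** transpose J) c \<eta>" and "subspace V" "x \<in> V" "y \<in> V"
  shows "c * (x \<bullet> y) - \<eta> * c * (((norm x)\<^sup>2 + (norm y)\<^sup>2) / 2) \<le> x \<bullet> ((J ** transpose J) *v y)"
proof -
  have quad: "u \<bullet> ((J ** transpose J) *v v) = (transpose J *v u) \<bullet> (transpose J *v v)" for u v
    by (simp add: inner_transpose_matrix_vector matrix_vector_mul_assoc)
  \<comment> \<open>Polarization needs near-isometry at the sum (lower bound) and at the difference
    (upper bound), hence on a subspace.\<close>
  have "x + y \<in> V" "x - y \<in> V"
    using assms subspace_add subspace_diff by blast+
  then have "(1 - \<eta>) * c * (norm (x + y))\<^sup>2 \<le> (x + y) \<bullet> ((J ** transpose J) *v (x + y))"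
    "(x - y) \<bullet> ((J ** transpose J) *v (x - y)) \<le> (1 + \<eta>) * c * (norm (x - y))\<^sup>2"
    using iso unfolding near_isometry_on_def by blast+
  moreover have "(x + y) \<bullet> ((J ** transpose J) *v (x + y)) - (x - y) \<bullet> ((J ** transpose J) *v (x - y))
      = 4 * (x \<bullet> ((J ** transpose J) *v y))"
    unfolding quad by (simp add: inner_commute algebra_simps)
  \<comment> \<open>The part without \<eta> polarizes to the inner product; the part with \<eta> is
    a sum of squares, evaluated by the parallelogram law.\<close>
  moreover have "(1 - \<eta>) * c * (norm (x + y))\<^sup>2 - (1 + \<eta>) * c * (norm (x - y))\<^sup>2
      = 4 * (c * (x \<bullet> y) - \<eta> * c * (((norm x)\<^sup>2 + (norm y)\<^sup>2) / 2))"
    unfolding power2_norm_eq_inner by (simp add: inner_commute algebra_simps)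
  moreover have "p \<le> q" if "A \<le> B" "C \<le> D" "B - C = 4 * q" "A - D = 4 * p" for A B C D p q :: real
    using that by linarith
  ultimately show ?thesis
    by blast
qed

text \<open>The triangle inequality is summed over the layers between \<open>a\<close> and
  \<open>b\<close>; the induction runs upward, and symmetry of the norm covers the other
  order.\<close>

lemma hidden_dist_le:
  assumes "\<And>l. l < L \<Longrightarrow> norm (hidden N (Suc l) - hidden N l) \<le> \<delta>" "a \<le> L" "b \<le> L"
  shows "norm (hidden N a - hidden N b) \<le> \<bar>real a - real b\<bar> * \<delta>"
proof -
  have "norm (hidden N (k + n) - hidden N k) \<le> real n * \<delta>" if "k + n \<le> L" for k n
    using that
  proof (induction n)
    case (Suc n)
    then show ?case
      using assms(1) [of "k + n"]
        norm_triangle_ineq [of "hidden N (Suc (k + n)) - hidden N (k + n)" "hidden N (k + n) - hidden N k"]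
      by (simp add: algebra_simps)
  qed simp
  from this [of a "b - a"] this [of b "a - b"] show ?thesis
    using assms(2,3) by (cases "a \<le> b") (auto simp: norm_minus_commute)
qed

lemma gram_perturbation_le:
  fixes J E F :: "real ^ 'n::finite ^ 'z::finite"
  shows "\<bar>(transpose (J + E) *v x) \<bullet> (transpose (J + F) *v y) - x \<bullet> ((J ** transpose J) *v y)\<bar>
    \<le> norm x * norm y * (opnorm E * opnorm J + opnorm F * opnorm J + opnorm E * opnorm F)"
proof -
  have cs: "\<bar>(transpose A *v x) \<bullet> (transpose B *v y)\<bar> \<le> norm x * norm y * (opnorm A * opnorm B)"
    for A B :: "real ^ 'n ^ 'z"
  proof -
    have "\<bar>(transpose A *v x) \<bullet> (transpose B *v y)\<bar> \<le> norm (transpose A *v x) * norm (transpose B *v y)"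
      by (rule Cauchy_Schwarz_ineq2)
    also have "\<dots> \<le> (opnorm A * norm x) * (opnorm B * norm y)"
      by (intro mult_mono norm_transpose_le_opnorm mult_nonneg_nonneg opnorm_nonneg) auto
    finally show ?thesis by (simp add: algebra_simps)
  qed
  have tr: "transpose (A + B) = transpose A + transpose B" for A B :: "real ^ 'n ^ 'z"
    by (simp add: transpose_def vec_eq_iff)
  have "x \<bullet> ((J ** transpose J) *v y) = (transpose J *v x) \<bullet> (transpose J *v y)"
    by (simp add: inner_transpose_matrix_vector matrix_vector_mul_assoc)
  \<comment> \<open>The pure \<open>J\<close> term cancels, and every remaining term contains
    \<open>E\<close> or \<open>F\<close>.\<close>
  then have "(transpose (J + E) *v x) \<bullet> (transpose (J + F) *v y) - x \<bullet> ((J ** transpose J) *v y)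
    = (transpose E *v x) \<bullet> (transpose J *v y) + (transpose J *v x) \<bullet> (transpose F *v y)
      + (transpose E *v x) \<bullet> (transpose F *v y)"
    by (simp add: tr matrix_vector_mult_add_rdistrib inner_add_left inner_add_right)
  then show ?thesis
    using cs [of E J] cs [of J F] cs [of E F] by (simp add: algebra_simps)
qed

text \<open>Separating the diagonal isolates the interference terms, so that pairwise lower bounds
  can be inserted one by one.\<close>

lemma norm_sum_scaleR_squared:
  fixes v :: "'i \<Rightarrow> 'a::real_inner"
  assumes "finite S"
  shows "(norm (\<Sum>l\<in>S. w l *\<^sub>R v l))\<^sup>2 =
    (\<Sum>l\<in>S. (w l)\<^sup>2 * (norm (v l))\<^sup>2) + (\<Sum>a\<in>S. \<Sum>b\<in>S - {a}. w a * w b * (v a \<bullet> v b))"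
proof -
  have "(norm (\<Sum>l\<in>S. w l *\<^sub>R v l))\<^sup>2 = (\<Sum>a\<in>S. \<Sum>b\<in>S. w a * w b * (v a \<bullet> v b))"
    unfolding power2_norm_eq_inner
    by (simp add: inner_sum_left inner_sum_right mult.assoc inner_commute sum_distrib_left mult.left_commute)
  also have "\<dots> = (\<Sum>a\<in>S. (w a)\<^sup>2 * (norm (v a))\<^sup>2 + (\<Sum>b\<in>S - {a}. w a * w b * (v a \<bullet> v b)))"
    using assms
    by (intro sum.cong refl) (simp add: sum.remove dot_square_norm power2_eq_square)
  finally show ?thesis
    by (simp add: sum.distrib)
qed

text \<open>The constant is chosen before the network, which makes the O-bound uniform; \<epsilon>
  is capped because \<open>(1 + \<epsilon>) ^ n - 1\<close> is not uniformly linear in an unbounded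
  \<epsilon>. The informal closing claim on coherence becomes a sign condition on interference and a
  lower bound on the superposed gradient.\<close>

theorem theoremH1:
  fixes L :: nat and \<epsilon>\<^sub>0 :: real
  assumes "0 < \<epsilon>\<^sub>0"
  shows "\<exists>C>0. \<forall>(N :: ('t::finite, 'm::finite, 'p, 'k::finite, 'z::finite) distillation) i \<epsilon>.
    well_posed N \<and> depth N = L \<and> i \<le> L \<and> 0 < \<epsilon> \<and> \<epsilon> \<le> \<epsilon>\<^sub>0 \<and> residual_small N i \<epsilon> \<longrightarrow>
    (\<exists>\<E>. GDERIV (\<lambda>x. align_loss N (rerun N i x)) (hidden N i) :>
            ((\<Sum>l\<in>later_layers N i.
                weight N l *\<^sub>R (transpose (proj_jac N l) *v err_signal N l)) + \<E>)
         \<and> norm \<E> \<le> C * (\<epsilon> * (\<Sum>l\<in>later_layers N i.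
                (real l - real i) * weight N l * norm (transpose (proj_jac N l) *v err_signal N l))))
    \<and>
    (\<forall>\<phi> \<delta> L\<^sub>J D lbar c \<eta> J M.
       (\<forall>l\<in>distill_layers N. proj N l = \<phi>)
       \<and> 0 < \<delta> \<and> (\<forall>l<L. norm (hidden N (Suc l) - hidden N l) \<le> \<delta>)
       \<and> 0 < L\<^sub>J \<and> bounded D \<and> hidden N ` distill_layers N \<subseteq> D
       \<and> (\<forall>x\<in>D. \<forall>y\<in>D. opnorm (jacobian (project \<phi>) (at x) - jacobian (project \<phi>) (at y))
              \<le> L\<^sub>J * norm (x - y))
       \<and> lbar \<in> distill_layers N
       \<and> J = jacobian (project \<phi>) (at (hidden N lbar)) \<and> M = J ** transpose J
       \<and> 0 < c \<and> 0 \<le> \<eta> \<and> \<eta> < 1 \<and> near_isometry_on (err_space N) M c \<eta>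
       \<longrightarrow>
       (\<exists>E \<Delta>.
          (\<forall>l\<in>distill_layers N.
             jacobian (project \<phi>) (at (hidden N l)) = J + E l
             \<and> opnorm (E l) \<le> L\<^sub>J * \<bar>real l - real lbar\<bar> * \<delta>)
          \<and> (\<forall>a\<in>distill_layers N. \<forall>b\<in>distill_layers N.
               i \<le> a \<and> i \<le> b \<and> err_signal N a \<in> err_space N \<and> err_signal N b \<in> err_space N \<longrightarrow>
               back_signal N a \<bullet> back_signal N b
                 = err_signal N a \<bullet> ((jacobian (project \<phi>) (at (hidden N a))
                      ** transpose (jacobian (project \<phi>) (at (hidden N b)))) *v err_signal N b)
               \<and> back_signal N a \<bullet> back_signal N b
                 = err_signal N a \<bullet> (M *v err_signal N b) + \<Delta> a b
               \<and> \<bar>\<Delta> a b\<bar> \<le> norm (err_signal N a) * norm (err_signal N b)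
                    * (opnorm (E a) * opnorm J + opnorm (E b) * opnorm J
                       + opnorm (E a) * opnorm (E b))
               \<and> back_signal N a \<bullet> back_signal N b
                 \<ge> c * (err_signal N a \<bullet> err_signal N b)
                    - \<eta> * c * (((norm (err_signal N a))\<^sup>2 + (norm (err_signal N b))\<^sup>2) / 2)
                    - \<bar>\<Delta> a b\<bar>
               \<and> (\<eta> * c * (((norm (err_signal N a))\<^sup>2 + (norm (err_signal N b))\<^sup>2) / 2) + \<bar>\<Delta> a b\<bar>
                    < c * (err_signal N a \<bullet> err_signal N b)
                  \<longrightarrow> 0 < back_signal N a \<bullet> back_signal N b))
          \<and> (norm (superposed N i))\<^sup>2
              \<ge> (\<Sum>l\<in>later_layers N i. (weight N l)\<^sup>2 * (norm (back_signal N l))\<^sup>2)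
                + (\<Sum>a\<in>later_layers N i. \<Sum>b\<in>later_layers N i - {a}.
                     weight N a * weight N b *
                     (c * (err_signal N a \<bullet> err_signal N b)
                      - \<eta> * c * (((norm (err_signal N a))\<^sup>2 + (norm (err_signal N b))\<^sup>2) / 2)
                      - \<bar>\<Delta> a b\<bar>))))"
proof -
  \<comment> \<open>This is the growth factor of \<open>power_growth_le\<close>, depending only on
    the cap and the depth.\<close>
  define K where "K = (1 + \<epsilon>\<^sub>0) ^ L"
  have "0 < K"
    using assms by (simp add: K_def)
  show ?thesis
  proof (intro exI [of _ K] conjI \<open>0 < K\<close> allI impI, goal_cases)
    case (1 N i \<epsilon>)
    then show ?case
      unfolding K_def back_signal_def [symmetric]
      by (intro align_loss_gradient_superposition) auto
  next
    case (2 N i \<epsilon> \<phi> \<delta> L\<^sub>J D lbar c \<eta> J M)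
    let ?S = "distill_layers N" and ?g = "err_signal N" and ?v = "back_signal N"
    let ?Jac = "\<lambda>l. jacobian (project \<phi>) (at (hidden N l))"
    have J: "J = ?Jac lbar" and M: "M = J ** transpose J" and lbar: "lbar \<in> ?S"
      using 2 by blast+
    have S: "?S \<subseteq> {..L}"
      using 2 by (auto simp: well_posed_def)
    have weight: "0 \<le> weight N l" if "l \<in> ?S" for l
      using 2 that by (auto simp: well_posed_def)
    \<comment> \<open>\<open>E\<close> and \<Delta> are defined as remainders, so both
      decompositions hold by construction and only the bounds need an argument.\<close>
    define E where "E = (\<lambda>l. ?Jac l - J)"
    define \<Delta> where "\<Delta> = (\<lambda>a b. ?v a \<bullet> ?v b - ?g a \<bullet> (M *v ?g b))"
    \<comment> \<open>Here sharing enters: all Jacobians belong to the single map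
      \<open>project \<phi>\<close>, at different points.\<close>
    have v: "?v l = transpose (J + E l) *v ?g l" if "l \<in> ?S" for l
      using 2 that by (auto simp: E_def back_signal_def proj_jac_def)
    have E_le: "opnorm (E l) \<le> L\<^sub>J * \<bar>real l - real lbar\<bar> * \<delta>" if l: "l \<in> ?S" for l
    proof -
      \<comment> \<open>The Lipschitz condition compares two distillation-layer states, which lie in
        \<open>D\<close>; the drift bound then passes through all layers between them.\<close>
      have "opnorm (E l) \<le> L\<^sub>J * norm (hidden N l - hidden N lbar)"
        unfolding E_def J using 2 l lbar by blast
      also have "norm (hidden N l - hidden N lbar) \<le> \<bar>real l - real lbar\<bar> * \<delta>"
        using 2 S l lbar by (intro hidden_dist_le [of L]) auto
      finally show ?thesis
        using 2 by (simp add: mult.assoc)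
    qed
    have \<Delta>_le: "\<bar>\<Delta> a b\<bar> \<le> norm (?g a) * norm (?g b)
        * (opnorm (E a) * opnorm J + opnorm (E b) * opnorm J + opnorm (E a) * opnorm (E b))"
      if "a \<in> ?S" "b \<in> ?S" for a b
      unfolding \<Delta>_def v [OF that(1)] v [OF that(2)] M by (rule gram_perturbation_le)
    have lower: "c * (?g a \<bullet> ?g b) - \<eta> * c * (((norm (?g a))\<^sup>2 + (norm (?g b))\<^sup>2) / 2) - \<bar>\<Delta> a b\<bar>
        \<le> ?v a \<bullet> ?v b" if "a \<in> ?S" "b \<in> ?S" for a b
    proof -
      \<comment> \<open>The error signals generate \<open>err_space N\<close>, so near-isometry
        applies to them and their combinations.\<close>
      have "?g a \<in> err_space N" "?g b \<in> err_space N"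
        using that by (auto simp: err_space_def span_base)
      then have "c * (?g a \<bullet> ?g b) - \<eta> * c * (((norm (?g a))\<^sup>2 + (norm (?g b))\<^sup>2) / 2)
          \<le> ?g a \<bullet> (M *v ?g b)"
        using 2 unfolding M
        by (intro near_isometry_inner_ge [of "err_space N"]) (auto simp: err_space_def)
      then show ?thesis
        by (simp add: \<Delta>_def)
    qed
    have gram: "?v a \<bullet> ?v b = ?g a \<bullet> ((?Jac a ** transpose (?Jac b)) *v ?g b)"
      if "a \<in> ?S" "b \<in> ?S" for a b
      unfolding v [OF that(1)] v [OF that(2)]
      by (simp add: E_def inner_transpose_matrix_vector matrix_vector_mul_assoc)
    have "finite (later_layers N i)"
      using S finite_subset unfolding later_layers_def by fastforce
    then have "(norm (superposed N i))\<^sup>2 = (\<Sum>l\<in>later_layers N i. (weight N l)\<^sup>2 * (norm (?v l))\<^sup>2)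
        + (\<Sum>a\<in>later_layers N i. \<Sum>b\<in>later_layers N i - {a}. weight N a * weight N b * (?v a \<bullet> ?v b))"
      unfolding superposed_def by (rule norm_sum_scaleR_squared)
    moreover have "(\<Sum>a\<in>later_layers N i. \<Sum>b\<in>later_layers N i - {a}. weight N a * weight N b *
          (c * (?g a \<bullet> ?g b) - \<eta> * c * (((norm (?g a))\<^sup>2 + (norm (?g b))\<^sup>2) / 2) - \<bar>\<Delta> a b\<bar>))
        \<le> (\<Sum>a\<in>later_layers N i. \<Sum>b\<in>later_layers N i - {a}. weight N a * weight N b * (?v a \<bullet> ?v b))"
      \<comment> \<open>Nonnegative weights preserve the direction of each pairwise bound.\<close>
      by (intro sum_mono mult_left_mono lower mult_nonneg_nonneg weight) (auto simp: later_layers_def)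
    ultimately have super: "(\<Sum>l\<in>later_layers N i. (weight N l)\<^sup>2 * (norm (?v l))\<^sup>2)
        + (\<Sum>a\<in>later_layers N i. \<Sum>b\<in>later_layers N i - {a}. weight N a * weight N b *
          (c * (?g a \<bullet> ?g b) - \<eta> * c * (((norm (?g a))\<^sup>2 + (norm (?g b))\<^sup>2) / 2) - \<bar>\<Delta> a b\<bar>))
        \<le> (norm (superposed N i))\<^sup>2"
      by simp
    show ?case
    proof (intro exI [of _ E] exI [of _ \<Delta>] conjI ballI impI, goal_cases)
      case (1 l)
      show ?case by (simp add: E_def)
    next
      case (2 l)
      then show ?case by (rule E_le)
    next
      case (3 a b)
      then show ?case by (intro gram)
    next
      case (4 a b)
      show ?case by (simp add: \<Delta>_def)
    next
      case (5 a b)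
      then show ?case by (intro \<Delta>_le)
    next
      case (6 a b)
      then show ?case by (intro lower)
    next
      case (7 a b)
      then show ?case using lower [of a b] by linarith
    next
      case 8
      show ?case by (rule super)
    qed
  qed
qed

end
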